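(* (a) There exist a finite GCD closed set $S=\{x_1,\ldots,x_n\}$ of distinct odd positive integers and a strictly monotone completely multiplicative function $f$ such that the $n\times n$ matrix whose $(i,j)$-entry is $f(\mathrm{lcm}(x_i,x_j))$ is singular. (b) There exist a finite LCM closed set $S=\{x_1,\ldots,x_n\}$ of distinct odd positive integers and a strictly monotone completely multiplicative function $f$ such that the $n\times n$ matrix whose $(i,j)$-entry is $f(\mathrm{lcm}(x_i,x_j))$ is singular.
   Context: A finite set $S$ of positive integers is GCD closed if $\gcd(a,b)\in S$ for all $a,b\in S$, and LCM closed if $\mathrm{lcm}(a,b)\in S$ for all $a,b\in S$. A function $f:\mathbb{Z}_+\to\mathbb{R}$ is completely multiplicative if $f(1)=1$ and $f(ab)=f(a)f(b)$ for all positive integers $a,b$; it is strictly monotone if it is strictly increasing or strictly decreasing. *)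

theory Defs
  imports Complex_Main "Jordan_Normal_Form.Determinant"
begin

definition gcd_closed :: "nat set \<Rightarrow> bool" where
  "gcd_closed S \<longleftrightarrow> (\<forall>a\<in>S. \<forall>b\<in>S. gcd a b \<in> S)"

definition lcm_closed :: "nat set \<Rightarrow> bool" where
  "lcm_closed S \<longleftrightarrow> (\<forall>a\<in>S. \<forall>b\<in>S. lcm a b \<in> S)"

text \<open>Functions on the positive integers are represented by functions on \<^typ>\<open>nat\<close>
  that are only constrained on positive arguments; the value at 0 is irrelevant.\<close>

definition completely_multiplicative :: "(nat \<Rightarrow> real) \<Rightarrow> bool" where
  "completely_multiplicative f \<longleftrightarrow>
     f 1 = 1 \<and> (\<forall>a>0. \<forall>b>0. f (a * b) = f a * f b)"

definition strictly_monotone :: "(nat \<Rightarrow> real) \<Rightarrow> bool" where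
  "strictly_monotone f \<longleftrightarrow> strict_mono_on {0<..} f \<or> strict_antimono_on {0<..} f"

definition lcm_matrix :: "(nat \<Rightarrow> real) \<Rightarrow> nat list \<Rightarrow> real mat" where
  "lcm_matrix f xs = mat (length xs) (length xs) (\<lambda>(i, j). f (lcm (xs ! i) (xs ! j)))"

end

(* For f n = n powr c we have f (lcm x y) = f x * f y / f (gcd x y), so on S = {1, p, q, N} with
   p, q coprime divisors of N the vector (1, -1/f p, -1/f q, 1/f N) is orthogonal to all rows except
   possibly that of N; singularity amounts to
     1 - p powr (-c) - q powr (-c) + N powr (-c) = 0.
   If N is much larger than p * q, the left side is negative for some small c > 0 and tends to 1,
   so it has a positive root. Here p = 3, q = 5, N = 15 ^ 4, and the root lies between 1/2 and 1.
   The involution x -> N / x exchanges gcds and lcms, so the same c serves for the LCM closed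
   set {N, N / p, N / q, 1}. *)

theory Submission imports Defs begin

text \<open>A nonzero kernel vector certifies singularity. Quantifying rows over the elements of
  \<open>xs\<close> lets a concrete list split into one equation per entry.\<close>

lemma det_lcm_matrix_eq_0I:
  assumes "k < length xs" and "v k \<noteq> 0"
    and "\<And>x. x \<in> set xs \<Longrightarrow> (\<Sum>j<length xs. f (lcm x (xs ! j)) * v j) = 0"
  shows "det (lcm_matrix f xs) = 0"
proof -
  let ?n = "length xs"
  have "lcm_matrix f xs \<in> carrier_mat ?n ?n"
    by (simp add: lcm_matrix_def)
  moreover have "vec ?n v \<noteq> 0\<^sub>v ?n"
    using assms(1,2) by (metis index_vec index_zero_vec(1))
  moreover have "lcm_matrix f xs *\<^sub>v vec ?n v = 0\<^sub>v ?n"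
    using assms(3)
    by (intro eq_vecI) (auto simp: lcm_matrix_def scalar_prod_def lessThan_atLeast0)
  ultimately show ?thesis
    by (metis det_0_iff_vec_prod_zero_field vec_carrier)
qed

lemma completely_multiplicative_powr:
  "completely_multiplicative (\<lambda>n. real n powr c)"
  by (simp add: completely_multiplicative_def powr_mult)

lemma strictly_monotone_powr:
  assumes "0 < c"
  shows "strictly_monotone (\<lambda>n. real n powr c)"
  using assms by (auto simp: strictly_monotone_def intro!: strict_mono_onI powr_less_mono2)

lemma exponent_exists:
  "\<exists>c::real. 0 < c \<and>
     1 - 1 / 3 powr c - 1 / 5 powr c + 1 / 50625 powr c = 0"
proof -
  let ?h = "\<lambda>c::real. 1 - 1 / 3 powr c - 1 / 5 powr c + 1 / 50625 powr c"
  have sqrt: "sqrt 50625 = 225"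
    by (rule real_sqrt_unique) (simp_all add: power2_eq_square)
  \<comment> \<open>These roundings give 1 / sqrt 3 + 1 / sqrt 5 > 1.02, more than the 1 + 1 / 225
    needed for a nonpositive value at 1/2.\<close>
  have "sqrt 3 \<le> 1.74" "sqrt 5 \<le> 2.24"
    by (rule real_le_lsqrt; simp add: power2_eq_square)+
  then have "1 / 1.74 \<le> 1 / sqrt 3" "1 / 2.24 \<le> 1 / sqrt (5::real)"
    by (intro divide_left_mono; simp)+
  then have "?h (1/2) \<le> 0"
    using sqrt by (simp add: powr_half_sqrt)
  moreover have "0 \<le> ?h 1"
    by simp
  moreover have "continuous_on {1/2..1} ?h"
    by (intro continuous_intros) auto
  ultimately obtain c where "1/2 \<le> c" "?h c = 0"
    using IVT'[of ?h "1/2" 0 1] by auto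
  then show ?thesis
    by (intro exI[of _ c]) auto
qed

theorem mainTheorem8:
  "(\<exists>(xs :: nat list) (f :: nat \<Rightarrow> real).
      distinct xs \<and> (\<forall>x\<in>set xs. 0 < x \<and> odd x) \<and> gcd_closed (set xs) \<and>
      completely_multiplicative f \<and> strictly_monotone f \<and>
      det (lcm_matrix f xs) = 0)
   \<and>
   (\<exists>(xs :: nat list) (f :: nat \<Rightarrow> real).
      distinct xs \<and> (\<forall>x\<in>set xs. 0 < x \<and> odd x) \<and> lcm_closed (set xs) \<and>
      completely_multiplicative f \<and> strictly_monotone f \<and>
      det (lcm_matrix f xs) = 0)"
proof -
  obtain c :: real where "0 < c"
    and root: "1 - 1 / 3 powr c - 1 / 5 powr c + 1 / 50625 powr c = 0"
    using exponent_exists by blast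
  define f :: "nat \<Rightarrow> real" where "f = (\<lambda>n. real n powr c)"
  have cm: "completely_multiplicative f" and mono: "strictly_monotone f"
    using \<open>0 < c\<close> completely_multiplicative_powr strictly_monotone_powr by (auto simp: f_def)
  have mult: "f (a * b) = f a * f b" if "0 < a" "0 < b" for a b
    using cm that by (simp add: completely_multiplicative_def)
  have [simp]: "f (Suc 0) = 1"
    using cm by (simp add: completely_multiplicative_def)
  have pos: "0 < f 3" "0 < f 5" "0 < f 50625"
    by (simp_all add: f_def)
  have root_f: "1 - 1 / f 3 - 1 / f 5 + 1 / f 50625 = 0"
    using root by (simp add: f_def)
  have f15: "f 15 = f 3 * f 5"
    using mult[of 3 5] by simp
  have quot: "f 16875 = f 50625 / f 3" "f 10125 = f 50625 / f 5"
    using mult[of 3 16875] mult[of 5 10125] pos by (simp_all add: field_simps)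
  \<comment> \<open>This is the row of 50625 applied to \<open>?v\<close> and also the row of 1
    applied to \<open>?w\<close>; the other rows vanish whatever \<open>c\<close> is.\<close>
  have root_scaled: "f 50625 - f 50625 / f 3 - f 50625 / f 5 + 1 = 0"
    using root_f pos by (simp add: field_simps)
  let ?xs = "[1, 3, 5, 50625] :: nat list"
  let ?ys = "[50625, 16875, 10125, 1] :: nat list"
  let ?v = "(!) [1, - 1 / f 3, - 1 / f 5, 1 / f 50625]"
  \<comment> \<open>With N = 50625, f (lcm (N/x) (N/y)) = f N * f (lcm x y) / (f x * f y). So the
    matrix of \<open>?ys\<close> is a diagonal rescaling of that of \<open>?xs\<close>, and
    multiplying each entry of \<open>?v\<close> by the matching f x yields
    \<open>?w\<close>.\<close>
  let ?w = "(!) [1, - 1, - 1, 1 :: real]"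
  have lcms: "lcm 3 5 = (15::nat)" "lcm 5 3 = (15::nat)" "lcm 3 50625 = (50625::nat)"
    "lcm 5 50625 = (50625::nat)" "lcm 50625 3 = (50625::nat)" "lcm 50625 5 = (50625::nat)"
    "lcm 50625 16875 = (50625::nat)" "lcm 50625 10125 = (50625::nat)"
    "lcm 16875 50625 = (50625::nat)" "lcm 10125 50625 = (50625::nat)"
    "lcm 16875 10125 = (50625::nat)" "lcm 10125 16875 = (50625::nat)"
    by (simp_all add: lcm_nat_def gcd_non_0_nat)
  have "gcd_closed (set ?xs)"
    by (simp add: gcd_closed_def gcd_non_0_nat)
  moreover have "lcm_closed (set ?ys)"
    by (simp add: lcm_closed_def lcms)
  moreover have "det (lcm_matrix f ?xs) = 0"
    using root_scaled pos
    by (intro det_lcm_matrix_eq_0I[where k = 0 and v = ?v])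
       (auto simp: lcms f15 lessThan_Suc)
  moreover have "det (lcm_matrix f ?ys) = 0"
    using root_scaled
    by (intro det_lcm_matrix_eq_0I[where k = 0 and v = ?w])
       (auto simp: lcms quot lessThan_Suc)
  moreover have "distinct ?xs" "\<forall>x\<in>set ?xs. 0 < x \<and> odd x"
    "distinct ?ys" "\<forall>x\<in>set ?ys. 0 < x \<and> odd x"
    by simp_all
  ultimately show ?thesis
    using cm mono by blast
qed

end
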